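(* Let $\mathbb{F}$ be a finite field, let $C \subseteq \mathbb{F}^n$ be a linear code of dimension $k$, let $G \in \mathbb{F}^{n\times k}$ be a generator matrix for $C$, let $k' < k$ be a parameter (a non-negative integer), and let $\mathrm{Enc}:\mathbb{F}^{k'}\to C$ be the $k'$-randomized encoding map for $G$. Let $C_X = C$, and let $C_Z \subseteq \mathbb{F}^n$ be the subspace of all vectors orthogonal to the span of the last $k-k'$ columns of $G$. Let $d_X$ be the smallest weight of a vector in $C_X\setminus C_Z^\perp$ and $d_Z$ the smallest weight of a vector in $C_Z\setminus C_X^\perp$. Then the following hold: 1. $C_X^\perp$ and $C_Z^\perp$ are orthogonal, i.e. $\langle c,c'\rangle = 0$ for all $c\in C_X^\perp$ and $c'\in C_Z^\perp$ (so $(C_X,C_Z)$ is a CSS code). 2. For every non-negative integer $e$: $d_X > 2e$ if and only if $\mathrm{Enc}$ is decodable from $e$ errors. 3. For every non-negative integer $t<n$: $d_Z > t$ if and only if $\mathrm{Enc}$ is $t$-ZK.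
   Context: For $u,v\in\mathbb{F}^n$, $\langle u,v\rangle=\sum_{i=1}^n u_iv_i$, and the weight $\mathrm{wt}(u)$ is the number of non-zero coordinates of $u$. A linear code is a linear subspace $C\subseteq\mathbb{F}^n$; its dual is $C^\perp=\{c'\in\mathbb{F}^n: \langle c',c\rangle=0 \text{ for all } c\in C\}$. A generator matrix for a linear code $C$ of dimension $k$ is a full-rank matrix $G\in\mathbb{F}^{n\times k}$ whose image (column span) is $C$. Randomized encoding map: the $k'$-randomized encoding map for $G$ is the random map $\mathrm{Enc}:\mathbb{F}^{k'}\to C$ which on input $m\in\mathbb{F}^{k'}$ samples a uniformly random $r\in\mathbb{F}^{k-k'}$ and outputs $G\cdot z$, where $z=(m,r)\in\mathbb{F}^k$ (the first $k'$ entries of $z$ are $m$ and the last $k-k'$ entries are $r$). $t$-ZK: for $t<n$, $\mathrm{Enc}$ is $t$-Zero-Knowledge ($t$-ZK) if for every $I\subseteq[n]=\{1,\dots,n\}$ of size $t$ and every pair of messages $m,m'\in\mathbb{F}^{k'}$, the restrictions $\mathrm{Enc}(m)|_I$ and $\mathrm{Enc}(m')|_I$ to the coordinates in $I$ are identically distributed. Decodability: $\mathrm{Enc}$ is decodable from $e$ errors if there is a deterministic (not necessarily efficient) algorithm $D$, i.e. a function $D:\mathbb{F}^n\to\mathbb{F}^{k'}$, such that for every $m\in\mathbb{F}^{k'}$ and every $y\in\mathbb{F}^n$ with $\mathrm{wt}(y)\le e$ one has $\Pr[D(\mathrm{Enc}(m)+y)=m]=1$. CSS code: a pair of linear codes $C_X,C_Z\subseteq\mathbb{F}^n$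 such that $\langle c,c'\rangle=0$ for all $c\in C_X^\perp$, $c'\in C_Z^\perp$. Convention: the minimum weight over an empty set is $+\infty$ (relevant only when $k'=0$). *)

theory Defs
  imports
    "HOL-Probability.Probability_Mass_Function"
    "HOL-Library.Extended_Nat"
    "Jordan_Normal_Form.DL_Rank"
begin

(* From here on, 'a vec, $ and \<bullet> refer to Jordan_Normal_Form.Matrix. *)
hide_type (open) Finite_Cartesian_Product.vec
hide_const (open) Finite_Cartesian_Product.vec
unbundle no vec_syntax
unbundle no inner_syntax

text \<open>Coordinates are indexed by \<open>{..<n}\<close> instead of \<open>{1..n}\<close>; the vectors of length \<open>n\<close>
  are \<open>carrier_vec n\<close>, and the finite field is the type \<open>'a\<close> itself.\<close>

definition wt :: "'a :: zero vec \<Rightarrow> nat" where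
  "wt u = card {i \<in> {..<dim_vec u}. u $ i \<noteq> 0}"

text \<open>In \<^typ>\<open>enat\<close> the infimum of a nonempty set is attained, and that of the empty set
  is \<open>\<infinity>\<close>.\<close>

definition min_wt :: "'a :: zero vec set \<Rightarrow> enat" where
  "min_wt S = (INF v\<in>S. enat (wt v))"

definition linear_code :: "nat \<Rightarrow> 'a :: field vec set \<Rightarrow> bool" where
  "linear_code n C \<longleftrightarrow> VectorSpace.subspace class_ring C (module_vec TYPE('a) n)"

definition code_dim :: "nat \<Rightarrow> 'a :: field vec set \<Rightarrow> nat" where
  "code_dim n C = vectorspace.dim class_ring ((module_vec TYPE('a) n)\<lparr>carrier := C\<rparr>)"

abbreviation vec_span :: "nat \<Rightarrow> 'a :: field vec set \<Rightarrow> 'a vec set" where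
  "vec_span n S \<equiv> LinearCombinations.module.span class_ring (module_vec TYPE('a) n) S"

abbreviation dual_code :: "nat \<Rightarrow> 'a :: field vec set \<Rightarrow> 'a vec set" where
  "dual_code n C \<equiv> vec_module.orthogonal_complement n C"

definition generator_matrix :: "nat \<Rightarrow> nat \<Rightarrow> 'a :: field mat \<Rightarrow> 'a vec set \<Rightarrow> bool" where
  "generator_matrix n k G C \<longleftrightarrow>
     G \<in> carrier_mat n k \<and> vec_space.rank n G = k \<and> vec_space.col_space n G = C"

definition css_code :: "nat \<Rightarrow> 'a :: field vec set \<Rightarrow> 'a vec set \<Rightarrow> bool" where
  "css_code n CX CZ \<longleftrightarrow> linear_code n CX \<and> linear_code n CZ \<and>
     (\<forall>c\<in>dual_code n CX. \<forall>c'\<in>dual_code n CZ. c \<bullet> c' = 0)"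

definition rand_enc ::
    "nat \<Rightarrow> nat \<Rightarrow> 'a :: {field, finite} mat \<Rightarrow> 'a vec \<Rightarrow> 'a vec pmf" where
  "rand_enc k k' G m =
     map_pmf (\<lambda>r. G *\<^sub>v (m @\<^sub>v r)) (pmf_of_set (carrier_vec (k - k')))"

definition zero_knowledge ::
    "nat \<Rightarrow> nat \<Rightarrow> ('a vec \<Rightarrow> 'a vec pmf) \<Rightarrow> nat \<Rightarrow> bool" where
  "zero_knowledge n k' Enc t \<longleftrightarrow>
     (\<forall>I m m'. I \<subseteq> {..<n} \<and> card I = t \<and> m \<in> carrier_vec k' \<and> m' \<in> carrier_vec k' \<longrightarrow>
        map_pmf (\<lambda>c. \<lambda>i\<in>I. c $ i) (Enc m) = map_pmf (\<lambda>c. \<lambda>i\<in>I. c $ i) (Enc m'))"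

definition decodable ::
    "nat \<Rightarrow> nat \<Rightarrow> ('a :: field vec \<Rightarrow> 'a vec pmf) \<Rightarrow> nat \<Rightarrow> bool" where
  "decodable n k' Enc e \<longleftrightarrow>
     (\<exists>D \<in> carrier_vec n \<rightarrow> carrier_vec k'. \<forall>m\<in>carrier_vec k'. \<forall>y\<in>carrier_vec n.
        wt y \<le> e \<longrightarrow> measure_pmf.prob (Enc m) {c. D (c + y) = m} = 1)"

end

theory Submission
  imports Defs
begin

text \<open>Let \<open>U\<close> be the span of the last \<open>k - k'\<close> columns of \<open>G\<close>. Since \<open>U\<close> is its own double dual,
  \<open>C\<^sub>Z\<^sup>\<bottom> = U\<close>, and since \<open>G\<close> is injective, the words of \<open>C - U\<close> are exactly the differences of
  encodings of distinct messages; this gives decodability. For zero knowledge, the encodings of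
  \<open>m\<close> restricted to \<open>I\<close> are uniform on a coset of \<open>U\<close> restricted to \<open>I\<close>. All these cosets coincide
  iff every word of \<open>C\<close> agrees on \<open>I\<close> with a word of \<open>U\<close>, and this fails iff some vector
  supported on \<open>I\<close> annihilates \<open>U\<close> but not \<open>C\<close>.\<close>

section \<open>Linear codes over a finite field and their duals\<close>

lemma finite_carrier_vec: "finite (carrier_vec n :: 'a :: finite vec set)"
proof -
  have "carrier_vec n \<subseteq> vec_of_list ` {xs :: 'a list. set xs \<subseteq> UNIV \<and> length xs = n}"
  proof
    fix v :: "'a vec"
    assume "v \<in> carrier_vec n"
    then show "v \<in> vec_of_list ` {xs. set xs \<subseteq> UNIV \<and> length xs = n}"
      by (intro image_eqI[of _ _ "list_of_vec v"]) (auto simp: vec_list)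
  qed
  then show ?thesis
    by (rule finite_subset) (intro finite_imageI finite_lists_length_eq finite)
qed

lemma linear_code_iff:
  "linear_code n (C :: 'a :: field vec set) \<longleftrightarrow>
     C \<subseteq> carrier_vec n \<and> 0\<^sub>v n \<in> C \<and> (\<forall>u\<in>C. \<forall>v\<in>C. u + v \<in> C) \<and> (\<forall>a. \<forall>v\<in>C. a \<cdot>\<^sub>v v \<in> C)"
  using vec_module[of n, where ?'a = 'a] vec_vs[of n, where ?'a = 'a]
  by (auto simp: linear_code_def subspace_def submodule_def module_vec_simps class_ring_simps)

lemma linear_code_diff:
  assumes "linear_code n C" "u \<in> C" "v \<in> C"
  shows "u - v \<in> C"
proof -
  have "u \<in> carrier_vec n" "v \<in> carrier_vec n" "u + (- 1) \<cdot>\<^sub>v v \<in> C"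
    using assms by (auto simp: linear_code_iff)
  moreover from this have "u + (- 1) \<cdot>\<^sub>v v = u - v"
    by auto
  ultimately show ?thesis
    by simp
qed

lemma mem_dual_code_iff: "w \<in> dual_code n C \<longleftrightarrow> w \<in> carrier_vec n \<and> (\<forall>c\<in>C. w \<bullet> c = 0)"
  by (simp add: vec_module.orthogonal_complement_def)

lemma linear_code_dual_code:
  assumes "C \<subseteq> carrier_vec n"
  shows "linear_code n (dual_code n C)"
  using assms
  by (auto simp: linear_code_iff mem_dual_code_iff subset_iff add_scalar_prod_distrib[of _ n])

text \<open>Take a code \<open>M \<supseteq> C\<close> that is maximal among those avoiding \<open>w\<close>. By maximality every vector is
  congruent modulo \<open>M\<close> to a multiple of \<open>w\<close>; the coefficients for the unit vectors form \<open>u\<close>.\<close>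

lemma exists_separating_vector:
  fixes C :: "'a :: {field, finite} vec set"
  assumes C: "linear_code n C" and w: "w \<in> carrier_vec n" "w \<notin> C"
  obtains u where "u \<in> dual_code n C" "u \<bullet> w = 1"
proof -
  let ?A = "{M. linear_code n M \<and> C \<subseteq> M \<and> w \<notin> M}"
  have "?A \<subseteq> Pow (carrier_vec n)"
    by (auto simp: linear_code_iff)
  then have "finite ?A"
    using finite_carrier_vec by (metis finite_Pow_iff finite_subset)
  moreover have "C \<in> ?A"
    using C w by simp
  ultimately obtain M where M: "M \<in> ?A" and max: "\<forall>N\<in>?A. M \<subseteq> N \<longrightarrow> M = N"
    by (meson finite_has_maximal2)
  have M0: "0\<^sub>v n \<in> M" and Madd: "\<And>u v. u \<in> M \<Longrightarrow> v \<in> M \<Longrightarrow> u + v \<in> M"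
    and Msm: "\<And>a v. v \<in> M \<Longrightarrow> a \<cdot>\<^sub>v v \<in> M" and Mc: "\<And>v. v \<in> M \<Longrightarrow> v \<in> carrier_vec n"
    and wM: "w \<notin> M" and lM: "linear_code n M"
    using M by (auto simp: linear_code_iff)
  have "\<exists>a. v - a \<cdot>\<^sub>v w \<in> M" if v: "v \<in> carrier_vec n" for v
  proof (cases "v \<in> M")
    case True
    moreover have "v - 0 \<cdot>\<^sub>v w = v"
      using v w by auto
    ultimately show ?thesis
      by metis
  next
    case False
    \<comment> \<open>\<open>N\<close> is \<open>M\<close> with \<open>v\<close> adjoined. It is a
      code properly larger than \<open>M\<close>, so maximality of \<open>M\<close> forces
      \<open>w\<close> into it.\<close>
    define N where "N = {x + a \<cdot>\<^sub>v v | x a. x \<in> M}"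
    have memN: "y \<in> N \<longleftrightarrow> (\<exists>x\<in>M. \<exists>a. y = x + a \<cdot>\<^sub>v v)" for y
      by (auto simp: N_def)
    have "M \<subseteq> N"
    proof
      fix x assume "x \<in> M"
      moreover have "x = x + 0 \<cdot>\<^sub>v v"
        using Mc[OF \<open>x \<in> M\<close>] v by auto
      ultimately show "x \<in> N"
        unfolding memN by blast
    qed
    have "v = 0\<^sub>v n + 1 \<cdot>\<^sub>v v"
      using v by auto
    then have "v \<in> N"
      unfolding memN using M0 by blast
    have "linear_code n N"
      unfolding linear_code_iff
    proof (intro conjI ballI allI)
      show "N \<subseteq> carrier_vec n"
        using v Mc by (auto simp: N_def)
      show "0\<^sub>v n \<in> N"
        using M0 \<open>M \<subseteq> N\<close> by auto
    next
      fix y z assume "y \<in> N" "z \<in> N"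
      then obtain x a x' a' where x: "x \<in> M" "y = x + a \<cdot>\<^sub>v v" "x' \<in> M" "z = x' + a' \<cdot>\<^sub>v v"
        by (auto simp: memN)
      then have "y + z = (x + x') + (a + a') \<cdot>\<^sub>v v"
        using v Mc[of x] Mc[of x'] by (intro eq_vecI) (auto simp: algebra_simps)
      then show "y + z \<in> N"
        unfolding memN using Madd x by blast
    next
      fix b y assume "y \<in> N"
      then obtain x a where x: "x \<in> M" "y = x + a \<cdot>\<^sub>v v"
        by (auto simp: memN)
      then have "b \<cdot>\<^sub>v y = b \<cdot>\<^sub>v x + (b * a) \<cdot>\<^sub>v v"
        using v Mc[of x] by (intro eq_vecI) (auto simp: algebra_simps)
      then show "b \<cdot>\<^sub>v y \<in> N"
        unfolding memN using Msm x by blast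
    qed
    then have "w \<in> N"
      using max M \<open>M \<subseteq> N\<close> \<open>v \<in> N\<close> False by blast
    then obtain x a where x: "x \<in> M" "w = x + a \<cdot>\<^sub>v v"
      by (auto simp: memN)
    have "a \<noteq> 0"
    proof
      assume "a = 0"
      then have "w = x"
        using x(2) Mc[OF x(1)] v by auto
      then show False
        using x(1) wM by simp
    qed
    then have "v - inverse a \<cdot>\<^sub>v w = (- inverse a) \<cdot>\<^sub>v x"
      unfolding x(2) using v Mc[OF x(1)] by (intro eq_vecI) (auto simp: field_simps)
    then show ?thesis
      using Msm x(1) by metis
  qed
  then have "\<forall>i. \<exists>a. unit_vec n i - a \<cdot>\<^sub>v w \<in> M"
    by auto
  then obtain a where a: "\<And>i. unit_vec n i - a i \<cdot>\<^sub>v w \<in> M"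
    by metis
  define u where "u = vec n a"
  have u: "u \<in> carrier_vec n"
    by (simp add: u_def)
  \<comment> \<open>Building \<open>v\<close> up coordinate by coordinate adds the congruences of
    the unit vectors. At \<open>j = n\<close> the prefix is \<open>v\<close> and the coefficient is
    \<open>u \<bullet> v\<close>.\<close>
  have prefix: "vec n (\<lambda>i. if i < j then v $ i else 0) - (\<Sum>i<j. a i * v $ i) \<cdot>\<^sub>v w \<in> M" for v j
  proof (induction j)
    case 0
    have "vec n (\<lambda>i. if i < 0 then v $ i else 0) - (\<Sum>i<0. a i * v $ i) \<cdot>\<^sub>v w = 0\<^sub>v n"
      using w by auto
    then show ?case
      using M0 by metis
  next
    case (Suc j)
    have "vec n (\<lambda>i. if i < Suc j then v $ i else 0) - (\<Sum>i<Suc j. a i * v $ i) \<cdot>\<^sub>v w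
      = (vec n (\<lambda>i. if i < j then v $ i else 0) - (\<Sum>i<j. a i * v $ i) \<cdot>\<^sub>v w)
        + v $ j \<cdot>\<^sub>v (unit_vec n j - a j \<cdot>\<^sub>v w)"
      using w by (intro eq_vecI) (auto simp: algebra_simps less_Suc_eq unit_vec_def)
    then show ?case
      using Madd[OF Suc Msm[OF a]] by simp
  qed
  have mod_M: "v - (u \<bullet> v) \<cdot>\<^sub>v w \<in> M" if v: "v \<in> carrier_vec n" for v
  proof -
    have "vec n (\<lambda>i. if i < n then v $ i else 0) = v"
      using v by auto
    moreover have "(\<Sum>i<n. a i * v $ i) = u \<bullet> v"
      using v by (auto simp: scalar_prod_def u_def lessThan_atLeast0)
    ultimately show ?thesis
      using prefix[of n v] by simp
  qed
  \<comment> \<open>As \<open>w\<close> is not in \<open>M\<close>, coefficients of \<open>w\<close>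
    modulo \<open>M\<close> are unique. A word of \<open>C\<close> already lies in \<open>M\<close>,
    so its coefficient is 0; that of \<open>w\<close> itself is 1.\<close>
  have multiple: "b = 0" if "b \<cdot>\<^sub>v w \<in> M" for b
  proof (rule ccontr)
    assume "b \<noteq> 0"
    then have "inverse b \<cdot>\<^sub>v (b \<cdot>\<^sub>v w) = w"
      by (auto simp: smult_smult_assoc)
    then show False
      using Msm[OF that] wM by metis
  qed
  have "u \<bullet> v = 0" if v: "v \<in> C" for v
  proof -
    have "v \<in> M" using M v by auto
    then have "v - (v - (u \<bullet> v) \<cdot>\<^sub>v w) \<in> M"
      using linear_code_diff[OF lM] mod_M Mc by blast
    moreover have "v - (v - (u \<bullet> v) \<cdot>\<^sub>v w) = (u \<bullet> v) \<cdot>\<^sub>v w"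
      using Mc[OF \<open>v \<in> M\<close>] w by auto
    ultimately show ?thesis
      using multiple by metis
  qed
  then have "u \<in> dual_code n C"
    using u by (simp add: mem_dual_code_iff)
  moreover have "w - (u \<bullet> w) \<cdot>\<^sub>v w = (1 - u \<bullet> w) \<cdot>\<^sub>v w"
    by (auto simp: algebra_simps)
  then have "u \<bullet> w = 1"
    using mod_M[OF w(1)] multiple[of "1 - u \<bullet> w"] by simp
  ultimately show thesis
    by (rule that)
qed

text \<open>A vector outside \<open>C\<close> has product 1 with some \<open>u\<close> in the dual
  of \<open>C\<close>, whereas everything in the double dual is orthogonal to this
  \<open>u\<close>.\<close>

lemma dual_dual_code:
  fixes C :: "'a :: {field, finite} vec set"
  assumes "linear_code n C"
  shows "dual_code n (dual_code n C) = C"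
proof
  show "C \<subseteq> dual_code n (dual_code n C)"
  proof
    fix c assume "c \<in> C"
    then show "c \<in> dual_code n (dual_code n C)"
      using assms by (auto simp: mem_dual_code_iff linear_code_iff comm_scalar_prod[of c n])
  qed
  show "dual_code n (dual_code n C) \<subseteq> C"
  proof
    fix c assume c: "c \<in> dual_code n (dual_code n C)"
    show "c \<in> C"
    proof (rule ccontr)
      assume "c \<notin> C"
      then obtain u where "u \<in> dual_code n C" "u \<bullet> c = 1"
        using exists_separating_vector[OF assms, of c] c by (auto simp: mem_dual_code_iff)
      then show False
        using c by (auto simp: mem_dual_code_iff comm_scalar_prod[of c n])
    qed
  qed
qed

section \<open>Weights, distances and unique decoding\<close>

lemma less_min_wt_iff: "enat t < min_wt S \<longleftrightarrow> (\<forall>v\<in>S. t < wt v)"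
  by (simp add: min_wt_def Suc_ile_eq[symmetric] le_INF_iff Suc_le_eq)

lemma wt_diff_le:
  fixes u v :: "'a :: ab_group_add vec"
  assumes "u \<in> carrier_vec n" "v \<in> carrier_vec n"
  shows "wt (u - v) \<le> wt u + wt v"
proof -
  have "wt (u - v) \<le> card ({i \<in> {..<n}. u $ i \<noteq> 0} \<union> {i \<in> {..<n}. v $ i \<noteq> 0})"
    using assms unfolding wt_def by (intro card_mono) auto
  also have "\<dots> \<le> wt u + wt v"
    using assms card_Un_le by (fastforce simp: wt_def)
  finally show ?thesis .
qed

text \<open>Up to \<open>e\<close> positions of the support of \<open>v\<close> go to
  \<open>z\<close>; the at most \<open>e\<close> remaining ones, negated, go to \<open>y\<close>.
  For \<open>v = c - c'\<close> this gives two close codewords a common received word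
  \<open>c + y = c' + z\<close>.\<close>

lemma wt_le_double_split:
  fixes v :: "'a :: ab_group_add vec"
  assumes v: "v \<in> carrier_vec n" and wt: "wt v \<le> 2 * e"
  obtains y z where "y \<in> carrier_vec n" "z \<in> carrier_vec n" "wt y \<le> e" "wt z \<le> e" "v + y = z"
proof -
  let ?S = "{i \<in> {..<n}. v $ i \<noteq> 0}"
  have card: "card ?S \<le> 2 * e"
    using v wt by (simp add: wt_def)
  obtain T where T: "T \<subseteq> ?S" "card T = min e (card ?S)" "finite T"
    using obtain_subset_with_card_n[of "min e (card ?S)" ?S] by auto
  define y where "y = vec n (\<lambda>i. if i \<in> T then 0 else - v $ i)"
  define z where "z = vec n (\<lambda>i. if i \<in> T then v $ i else 0)"
  have "wt y \<le> card (?S - T)"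
    unfolding wt_def y_def by (intro card_mono) (auto split: if_splits)
  also have "\<dots> \<le> e"
    using T card by (simp add: card_Diff_subset)
  finally have "wt y \<le> e" .
  moreover have "wt z \<le> card T"
    unfolding wt_def z_def using T by (intro card_mono) (auto split: if_splits)
  then have "wt z \<le> e"
    using T by simp
  moreover have "v + y = z"
    using v by (intro eq_vecI) (auto simp: y_def z_def)
  ultimately show thesis
    using that[of y z] by (simp add: y_def z_def)
qed

text \<open>Encodings of distinct messages within distance \<open>2 * e\<close> share a received
  word, which no deterministic decoder can resolve. Otherwise a received word with at most
  \<open>e\<close> errors determines its message, and the decoder returns it.\<close>

lemma decodable_iff_distance:
  fixes Enc :: "'a :: field vec \<Rightarrow> 'a vec pmf"
  assumes Enc: "\<And>m. m \<in> carrier_vec k' \<Longrightarrow> set_pmf (Enc m) \<subseteq> carrier_vec n"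
  shows "decodable n k' Enc e \<longleftrightarrow>
    (\<forall>m\<in>carrier_vec k'. \<forall>m'\<in>carrier_vec k'. \<forall>c\<in>set_pmf (Enc m). \<forall>c'\<in>set_pmf (Enc m').
       m \<noteq> m' \<longrightarrow> 2 * e < wt (c - c'))" (is "_ \<longleftrightarrow> ?dist")
proof -
  \<comment> \<open>An event has probability 1 exactly when it holds on the whole support, so
    decoding must succeed for every outcome of the randomness.\<close>
  have prob: "measure_pmf.prob (Enc m) {c. P c} = 1 \<longleftrightarrow> (\<forall>c\<in>set_pmf (Enc m). P c)" for m P
    by (subst measure_pmf.prob_eq_1) (auto simp: AE_measure_pmf_iff)
  show ?thesis
  proof
    assume "decodable n k' Enc e"
    then obtain D where D: "\<And>m c y. m \<in> carrier_vec k' \<Longrightarrow> y \<in> carrier_vec n \<Longrightarrow> wt y \<le> e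
        \<Longrightarrow> c \<in> set_pmf (Enc m) \<Longrightarrow> D (c + y) = m"
      unfolding decodable_def prob by blast
    show ?dist
    proof (intro ballI impI, rule ccontr)
      fix m m' c c'
      assume m: "m \<in> carrier_vec k'" "m' \<in> carrier_vec k'" "m \<noteq> m'"
        and c: "c \<in> set_pmf (Enc m)" "c' \<in> set_pmf (Enc m')" and "\<not> 2 * e < wt (c - c')"
      have cc: "c \<in> carrier_vec n" "c' \<in> carrier_vec n"
        using Enc m c by auto
      then obtain y z where yz: "y \<in> carrier_vec n" "z \<in> carrier_vec n" "wt y \<le> e" "wt z \<le> e"
          "c - c' + y = z"
        using wt_le_double_split[of "c - c'" n e] \<open>\<not> 2 * e < wt (c - c')\<close> by auto
      have "c + y = c' + z"
        using cc yz(1) unfolding yz(5)[symmetric] by (intro eq_vecI) auto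
      then show False
        using D[OF m(1) yz(1,3) c(1)] D[OF m(2) yz(2,4) c(2)] m(3) by simp
    qed
  next
    assume dist: ?dist
    \<comment> \<open>\<open>?P x m\<close> says that \<open>m\<close> can produce the received word
      \<open>x\<close> with at most \<open>e\<close> errors; by the triangle inequality at most one
      \<open>m\<close> can.\<close>
    let ?P = "\<lambda>x m. m \<in> carrier_vec k' \<and>
      (\<exists>c y. c \<in> set_pmf (Enc m) \<and> y \<in> carrier_vec n \<and> wt y \<le> e \<and> x = c + y)"
    have unique: "m = m'" if P: "?P x m" "?P x m'" for x m m'
    proof (rule ccontr)
      assume "m \<noteq> m'"
      obtain c y c' y' where c: "c \<in> set_pmf (Enc m)" "c' \<in> set_pmf (Enc m')"
        and y: "y \<in> carrier_vec n" "y' \<in> carrier_vec n" "wt y \<le> e" "wt y' \<le> e"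
        and eq: "c + y = c' + y'"
        using P by auto
      have cc: "c \<in> carrier_vec n" "c' \<in> carrier_vec n"
        using Enc P c by auto
      have "c - c' = y' - y"
      proof (rule eq_vecI)
        fix i assume "i < dim_vec (y' - y)"
        then have "(c + y) $ i = c $ i + y $ i" "(c' + y') $ i = c' $ i + y' $ i"
          using cc y by auto
        then show "(c - c') $ i = (y' - y) $ i"
          using \<open>i < dim_vec (y' - y)\<close> eq cc y by (auto simp: algebra_simps)
      qed (use cc y in auto)
      then have "wt (c - c') \<le> 2 * e"
        using wt_diff_le[OF y(2,1)] y(3,4) by simp
      moreover have "2 * e < wt (c - c')"
        using dist P c \<open>m \<noteq> m'\<close> by blast
      ultimately show False
        by simp
    qed
    \<comment> \<open>Words too far from every encoding get the zero message by default, which keeps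
      \<open>D\<close> inside \<open>carrier_vec k'\<close>.\<close>
    define D where "D x = (if \<exists>m. ?P x m then SOME m. ?P x m else 0\<^sub>v k')" for x
    have D_eq: "D x = m" if "?P x m" for x m
    proof -
      have "?P x (SOME m. ?P x m)"
        by (rule someI[of "?P x", OF that])
      then have "(SOME m. ?P x m) = m"
        using that by (rule unique)
      then show ?thesis
        using that by (auto simp: D_def)
    qed
    have "D x \<in> carrier_vec k'" for x
    proof (cases "\<exists>m. ?P x m")
      case True
      then obtain m where m: "?P x m"
        by blast
      then show ?thesis
        using D_eq[OF m] by simp
    next
      case False
      then show ?thesis
        unfolding D_def if_not_P[OF False] by simp
    qed
    then show "decodable n k' Enc e"
      unfolding decodable_def prob using D_eq by (intro bexI[of _ D]) blast+
  qed
qed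

section \<open>Injectivity of the generator matrix and the span of its last columns\<close>

lemma full_rank_mult_eq_0:
  fixes G :: "'a :: field mat"
  assumes G: "G \<in> carrier_mat n k" and rank: "vec_space.rank n G = k"
    and z: "z \<in> carrier_vec k" "G *\<^sub>v z = 0\<^sub>v n"
  shows "z = 0\<^sub>v k"
proof -
  interpret vec_space "TYPE('a)" n .
  \<comment> \<open>Linear independence concerns the set of columns, so repetitions are excluded
    first: with one, fewer than \<open>k\<close> distinct columns would bound the rank.\<close>
  have "distinct (cols G)"
  proof (rule ccontr)
    assume "\<not> distinct (cols G)"
    then have "card (set (cols G)) < k"
      using G card_length[of "cols G"] card_distinct[of "cols G"] by fastforce
    moreover obtain S where S: "maximal S (\<lambda>T. T \<subseteq> set (cols G) \<and> lin_indpt T)"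
      using maximal_exists[of "\<lambda>T. T \<subseteq> set (cols G) \<and> lin_indpt T" "card (set (cols G))" "{}"]
      by (meson List.finite_set card_mono empty_iff empty_subsetI finite_lin_indpt2 rev_finite_subset)
    then have "rank G \<le> card (set (cols G))"
      using rank_card_indpt[OF G S] by (simp add: card_mono maximal_def)
    ultimately show False
      using rank by simp
  qed
  then show ?thesis
    using lin_depI[OF G z(1) _ z(2)] full_rank_lin_indpt[OF G rank] by blast
qed

lemma append_vec_diff:
  fixes v :: "'a :: ab_group_add vec"
  assumes "v \<in> carrier_vec n" "v' \<in> carrier_vec n" "w \<in> carrier_vec m" "w' \<in> carrier_vec m"
  shows "(v @\<^sub>v w) - (v' @\<^sub>v w') = (v - v') @\<^sub>v (w - w')"
  using assms by (intro eq_vecI) auto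

lemma mult_mat_vec_append_0:
  fixes G :: "'a :: field mat"
  assumes G: "G \<in> carrier_mat n (k + l)" and r: "r \<in> carrier_vec l"
  shows "G *\<^sub>v (0\<^sub>v k @\<^sub>v r) = mat_of_cols n (drop k (cols G)) *\<^sub>v r"
proof (rule eq_vecI)
  fix i assume "i < dim_vec (mat_of_cols n (drop k (cols G)) *\<^sub>v r)"
  then have i: "i < n" by simp
  have "row G i = vec_first (row G i) k @\<^sub>v vec_last (row G i) l"
    using G i vec_first_last_append[of "row G i" k l] by simp
  then have "row G i \<bullet> (0\<^sub>v k @\<^sub>v r) = vec_first (row G i) k \<bullet> 0\<^sub>v k + vec_last (row G i) l \<bullet> r"
    using r by (metis scalar_prod_append vec_first_carrier vec_last_carrier zero_carrier_vec)
  moreover have "vec_last (row G i) l = row (mat_of_cols n (drop k (cols G))) i"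
    using G i by (intro eq_vecI) (auto simp: vec_last_def mat_of_cols_index)
  ultimately show "(G *\<^sub>v (0\<^sub>v k @\<^sub>v r)) $ i = (mat_of_cols n (drop k (cols G)) *\<^sub>v r) $ i"
    using G i by simp
qed (use G in simp)

text \<open>Zeros in the first \<open>k\<close> entries cancel the first \<open>k\<close> columns,
  so only the tail columns act. This identifies the span \<open>U\<close> with the set of encodings
  of the zero message.\<close>

lemma span_drop_cols:
  fixes G :: "'a :: field mat"
  assumes G: "G \<in> carrier_mat n (k + l)"
  shows "vec_span n (set (drop k (cols G))) = (\<lambda>r. G *\<^sub>v (0\<^sub>v k @\<^sub>v r)) ` carrier_vec l"
proof -
  interpret vec_space "TYPE('a)" n .
  let ?H = "mat_of_cols n (drop k (cols G))"
  have H: "?H \<in> carrier_mat n l"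
    using G by (intro carrier_matI) auto
  have "set (drop k (cols G)) \<subseteq> carrier_vec n"
    using G cols_dim[of G] set_drop_subset[of k "cols G"] by auto
  then have "cols ?H = drop k (cols G)"
    by (rule cols_mat_of_cols)
  then have "span (set (drop k (cols G))) = col_space ?H"
    by (simp add: col_space_def)
  also have "\<dots> = (\<lambda>r. ?H *\<^sub>v r) ` carrier_vec l"
    using G H by (auto simp: col_space_eq[OF H])
  finally show ?thesis
    using mult_mat_vec_append_0[OF G] by simp
qed

lemma carrier_vec_append_cases:
  assumes "z \<in> carrier_vec (k + l)"
  obtains m r where "m \<in> carrier_vec k" "r \<in> carrier_vec l" "z = m @\<^sub>v r"
  using assms vec_first_last_append[of z k l] by (metis vec_first_carrier vec_last_carrier)

section \<open>The randomized encoding and restriction to a coordinate set\<close>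

lemma set_pmf_rand_enc:
  "set_pmf (rand_enc k k' G m) = (\<lambda>r. G *\<^sub>v (m @\<^sub>v r)) ` carrier_vec (k - k')"
  unfolding rand_enc_def
  by (subst set_map_pmf, subst set_pmf_of_set)
    (auto simp: finite_carrier_vec intro: zero_carrier_vec)

text \<open>Translation by \<open>r\<^sub>0\<close> preserves the uniform distribution of the random tail.\<close>

lemma map_rand_enc_cong:
  fixes G :: "'a :: {field, finite} mat"
  assumes r\<^sub>0: "r\<^sub>0 \<in> carrier_vec (k - k')"
    and f: "\<And>r. r \<in> carrier_vec (k - k') \<Longrightarrow>
      f (G *\<^sub>v (m @\<^sub>v r)) = f (G *\<^sub>v (m' @\<^sub>v (r + r\<^sub>0)))"
  shows "map_pmf f (rand_enc k k' G m) = map_pmf f (rand_enc k k' G m')"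
proof -
  let ?R = "carrier_vec (k - k') :: 'a vec set"
  have R: "finite ?R" "?R \<noteq> {}"
    using finite_carrier_vec zero_carrier_vec by blast+
  have "bij_betw (\<lambda>r. r + r\<^sub>0) ?R ?R"
    by (rule bij_betw_byWitness[of _ "\<lambda>r. r - r\<^sub>0"]) (use r\<^sub>0 in auto)
  then have shift: "map_pmf (\<lambda>r. r + r\<^sub>0) (pmf_of_set ?R) = pmf_of_set ?R"
    by (rule map_pmf_of_set_bij_betw[OF _ R(2,1)])
  have "map_pmf f (rand_enc k k' G m) = map_pmf (\<lambda>r. f (G *\<^sub>v (m' @\<^sub>v (r + r\<^sub>0)))) (pmf_of_set ?R)"
    unfolding rand_enc_def pmf.map_comp o_def
    by (rule map_pmf_cong) (use f R in auto)
  also have "\<dots> = map_pmf (\<lambda>r. f (G *\<^sub>v (m' @\<^sub>v r))) (map_pmf (\<lambda>r. r + r\<^sub>0) (pmf_of_set ?R))"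
    by (simp add: pmf.map_comp o_def)
  also have "\<dots> = map_pmf f (rand_enc k k' G m')"
    unfolding shift by (simp add: rand_enc_def pmf.map_comp o_def)
  finally show ?thesis .
qed

text \<open>A word that agrees with no codeword of \<open>C\<close> on \<open>I\<close> lies outside the code of all words
  agreeing on \<open>I\<close> with a codeword; a vector separating them is supported on \<open>I\<close>, because
  that code contains the unit vectors outside \<open>I\<close>.\<close>

lemma dual_code_witness_on:
  fixes C :: "'a :: {field, finite} vec set"
  assumes C: "linear_code n C" and I: "I \<subseteq> {..<n}" and c: "c \<in> carrier_vec n"
    and noncong: "\<And>u. u \<in> C \<Longrightarrow> \<exists>i\<in>I. c $ i \<noteq> u $ i"
  obtains w where "w \<in> dual_code n C" "w \<bullet> c \<noteq> 0" "wt w \<le> card I"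
proof -
  define N where "N = {v \<in> carrier_vec n. \<exists>u\<in>C. \<forall>i\<in>I. v $ i = u $ i}"
  have Cc: "\<And>u. u \<in> C \<Longrightarrow> u \<in> carrier_vec n"
    using C by (auto simp: linear_code_iff)
  have In: "\<And>i. i \<in> I \<Longrightarrow> i < n"
    using I by auto
  have "linear_code n N"
    unfolding linear_code_iff
  proof (intro conjI ballI allI)
    show "N \<subseteq> carrier_vec n" "0\<^sub>v n \<in> N"
      using C by (auto simp: N_def linear_code_iff)
  next
    fix x y assume "x \<in> N" "y \<in> N"
    then obtain u v where uv: "u \<in> C" "v \<in> C" "\<forall>i\<in>I. x $ i = u $ i" "\<forall>i\<in>I. y $ i = v $ i"
      and xy: "x \<in> carrier_vec n" "y \<in> carrier_vec n"
      by (auto simp: N_def)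
    have "u + v \<in> C" "\<forall>i\<in>I. (x + y) $ i = (u + v) $ i"
      using C uv xy Cc[OF uv(1)] Cc[OF uv(2)] In by (auto simp: linear_code_iff)
    then show "x + y \<in> N"
      using xy by (auto simp: N_def)
  next
    fix a x assume "x \<in> N"
    then obtain u where u: "u \<in> C" "\<forall>i\<in>I. x $ i = u $ i" and x: "x \<in> carrier_vec n"
      by (auto simp: N_def)
    have "a \<cdot>\<^sub>v u \<in> C" "\<forall>i\<in>I. (a \<cdot>\<^sub>v x) $ i = (a \<cdot>\<^sub>v u) $ i"
      using C u x Cc[OF u(1)] In by (auto simp: linear_code_iff)
    then show "a \<cdot>\<^sub>v x \<in> N"
      using x by (auto simp: N_def)
  qed
  moreover have "c \<notin> N"
    using noncong by (auto simp: N_def)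
  ultimately obtain w where w: "w \<in> dual_code n N" "w \<bullet> c = 1"
    using c exists_separating_vector by blast
  then have wc: "w \<in> carrier_vec n"
    by (simp add: mem_dual_code_iff)
  have "C \<subseteq> N"
    using Cc by (auto simp: N_def)
  then have "w \<in> dual_code n C"
    using w by (auto simp: mem_dual_code_iff)
  moreover have "w $ j = 0" if j: "j < n" "j \<notin> I" for j
  proof -
    have "\<forall>i\<in>I. unit_vec n j $ i = (0\<^sub>v n :: 'a vec) $ i"
      using j In by (auto simp: unit_vec_def)
    then have "unit_vec n j \<in> N"
      using C by (auto simp: N_def linear_code_iff)
    then show ?thesis
      using w wc j by (auto simp: mem_dual_code_iff)
  qed
  then have "wt w \<le> card I"
    using wc I finite_subset[OF I] unfolding wt_def by (intro card_mono) auto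
  ultimately show thesis
    using w that by simp
qed

text \<open>Coordinates outside the support of \<open>w\<close> contribute nothing. In the
  zero-knowledge argument, a \<open>w\<close> supported on \<open>I\<close> therefore cannot tell
  apart words that agree on \<open>I\<close>.\<close>

lemma scalar_prod_cong_supp:
  assumes "w \<in> carrier_vec n" "u \<in> carrier_vec n" "v \<in> carrier_vec n"
    and "\<And>i. i < n \<Longrightarrow> w $ i \<noteq> 0 \<Longrightarrow> u $ i = v $ i"
  shows "w \<bullet> u = w \<bullet> (v :: 'a :: semiring_0 vec)"
  unfolding scalar_prod_def using assms by (intro sum.cong) (auto, metis mult_zero_left)

theorem theorem3p1:
  fixes C CX CZ :: "'a :: {field, finite} vec set" and G :: "'a mat"
    and n k k' :: nat and dX dZ :: enat
    and Enc :: "'a vec \<Rightarrow> 'a vec pmf"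
  assumes "linear_code n C" and "code_dim n C = k"
    and "generator_matrix n k G C"
    and "k' < k"
    and "Enc = rand_enc k k' G"
    and "CX = C"
    and "CZ = dual_code n (vec_span n (set (drop k' (cols G))))"
    and "dX = min_wt (CX - dual_code n CZ)"
    and "dZ = min_wt (CZ - dual_code n CX)"
  shows "css_code n CX CZ
    \<and> (\<forall>e. dX > enat (2 * e) \<longleftrightarrow> decodable n k' Enc e)
    \<and> (\<forall>t<n. dZ > enat t \<longleftrightarrow> zero_knowledge n k' Enc t)"
proof -

  \<comment> \<open>The encoding as a linear map of message and randomness, and the code
    \<open>U\<close>\<close>
  define l where "l = k - k'"
  have k: "k = k' + l"
    using \<open>k' < k\<close> by (simp add: l_def)
  have G: "G \<in> carrier_mat n (k' + l)" and rank: "vec_space.rank n G = k' + l"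
    and colsp: "vec_space.col_space n G = C"
    using assms(3) by (auto simp: generator_matrix_def k)
  define enc where "enc m r = G *\<^sub>v (m @\<^sub>v r)" for m r
  have enc_carrier: "enc m r \<in> carrier_vec n" for m r
    using G by (intro carrier_vecI) (auto simp: enc_def)
  have app: "m @\<^sub>v r \<in> carrier_vec (k' + l)" if "m \<in> carrier_vec k'" "r \<in> carrier_vec l"
    for m r :: "'a vec"
    using that by simp
  have enc_add: "enc m r + enc m' r' = enc (m + m') (r + r')"
    and enc_diff: "enc m r - enc m' r' = enc (m - m') (r - r')"
    if "m \<in> carrier_vec k'" "m' \<in> carrier_vec k'" "r \<in> carrier_vec l" "r' \<in> carrier_vec l"
    for m m' r r'
    unfolding enc_def using that G app append_vec_add[of m k' m' r l r'] append_vec_diff[of m k' m' r l r']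
    by (metis mult_add_distrib_mat_vec, metis mult_minus_distrib_mat_vec)
  have set_Enc: "set_pmf (Enc m) = enc m ` carrier_vec l" for m
    by (simp add: assms(5) set_pmf_rand_enc l_def enc_def[abs_def])
  define U where "U = vec_span n (set (drop k' (cols G)))"
  have U: "U = enc (0\<^sub>v k') ` carrier_vec l"
    unfolding U_def span_drop_cols[OF G] enc_def ..
  have CZ: "CZ = dual_code n U"
    by (simp add: assms(7) U_def)
  have memC: "c \<in> C \<longleftrightarrow> (\<exists>m\<in>carrier_vec k'. \<exists>r\<in>carrier_vec l. c = enc m r)" for c
  proof -
    interpret vec_space "TYPE('a)" n .
    have "c \<in> C \<longleftrightarrow> (\<exists>z\<in>carrier_vec (k' + l). c = G *\<^sub>v z)"
      using G enc_carrier unfolding colsp[symmetric] col_space_eq[OF G] by auto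
    then show ?thesis
      unfolding enc_def using app by (metis carrier_vec_append_cases)
  qed
  have UC: "U \<subseteq> C"
    unfolding U using memC zero_carrier_vec by blast
  have Ucar: "U \<subseteq> carrier_vec n"
    using enc_carrier by (auto simp: U)
  have linU: "linear_code n U"
  proof -
    interpret vec_space "TYPE('a)" n .
    have "set (drop k' (cols G)) \<subseteq> carrier_vec n"
      using G cols_dim[of G] set_drop_subset[of k' "cols G"] by auto
    then show ?thesis
      unfolding linear_code_def U_def by (rule span_is_subspace)
  qed
  have dualCZ: "dual_code n CZ = U"
    unfolding CZ by (rule dual_dual_code[OF linU])
  \<comment> \<open>Subtracting an encoding of the zero message with the same value gives a vector
    killed by \<open>G\<close>; injectivity makes that vector zero, and with it its head
    \<open>m\<close>.\<close>
  have encU: "enc m r \<in> U \<longleftrightarrow> m = 0\<^sub>v k'" if mr: "m \<in> carrier_vec k'" "r \<in> carrier_vec l" for m r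
  proof
    assume "enc m r \<in> U"
    then obtain r' where r': "r' \<in> carrier_vec l" "enc m r = enc (0\<^sub>v k') r'"
      by (auto simp: U)
    then have "enc (m - 0\<^sub>v k') (r - r') = 0\<^sub>v n"
      using enc_diff[of m "0\<^sub>v k'" r r'] mr minus_cancel_vec[OF enc_carrier] by simp
    then have "(m - 0\<^sub>v k') @\<^sub>v (r - r') = 0\<^sub>v (k' + l)"
      unfolding enc_def using full_rank_mult_eq_0[OF G rank] app mr r' by simp
    also have "\<dots> = 0\<^sub>v k' @\<^sub>v 0\<^sub>v l"
      by auto
    finally have "m - 0\<^sub>v k' = 0\<^sub>v k'"
      using mr by (subst (asm) append_vec_eq[of _ k']) auto
    then show "m = 0\<^sub>v k'"
      using mr by simp
  qed (use mr U in auto)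

  \<comment> \<open>Orthogonality of the two duals\<close>
  have "css_code n CX CZ"
    \<comment> \<open>The dual of \<open>CZ\<close> is \<open>U\<close>, a subset of
      \<open>C\<close>, hence orthogonal to the dual of \<open>CX\<close>.\<close>
    unfolding css_code_def dualCZ
    using assms(1,6) UC Ucar linear_code_dual_code[OF Ucar] by (auto simp: CZ mem_dual_code_iff)

  \<comment> \<open>Distance and decodability\<close>
  moreover have "dX > enat (2 * e) \<longleftrightarrow> decodable n k' Enc e" for e
  proof -
    have "decodable n k' Enc e \<longleftrightarrow> (\<forall>m\<in>carrier_vec k'. \<forall>m'\<in>carrier_vec k'. \<forall>r\<in>carrier_vec l.
        \<forall>r'\<in>carrier_vec l. m \<noteq> m' \<longrightarrow> 2 * e < wt (enc m r - enc m' r'))"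
      using enc_carrier by (subst decodable_iff_distance) (auto simp: set_Enc)
    \<comment> \<open>A word of \<open>C - U\<close> is its own difference from the zero encoding of
      the zero message. Conversely, a difference of encodings encodes the nonzero message
      \<open>m - m'\<close>, so it lies outside \<open>U\<close>.\<close>
    also have "\<dots> \<longleftrightarrow> (\<forall>v\<in>C - U. 2 * e < wt v)" (is "?L \<longleftrightarrow> ?R")
    proof
      assume L: ?L
      show ?R
      proof
        fix v assume v: "v \<in> C - U"
        then obtain m r where mr: "m \<in> carrier_vec k'" "r \<in> carrier_vec l" "v = enc m r"
          using memC by auto
        then have "m \<noteq> 0\<^sub>v k'"
          using v encU by auto
        moreover have "enc m r - enc (0\<^sub>v k') (0\<^sub>v l) = v"
          using mr by (subst enc_diff) auto
        ultimately show "2 * e < wt v"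
          using L mr by (metis zero_carrier_vec)
      qed
    next
      assume R: ?R
      show ?L
      proof (intro ballI impI)
        fix m m' r r' :: "'a vec"
        assume mr: "m \<in> carrier_vec k'" "m' \<in> carrier_vec k'" "r \<in> carrier_vec l"
            "r' \<in> carrier_vec l" and "m \<noteq> m'"
        have "m - m' \<noteq> 0\<^sub>v k'"
        proof
          assume "m - m' = 0\<^sub>v k'"
          then have "m - m' + m' = m'"
            using mr by simp
          moreover have "m - m' + m' = m"
            using mr by auto
          ultimately show False
            using \<open>m \<noteq> m'\<close> by simp
        qed
        moreover have diff: "m - m' \<in> carrier_vec k'" "r - r' \<in> carrier_vec l"
          using mr by auto
        ultimately have "enc (m - m') (r - r') \<in> C - U"
          using encU[OF diff] memC by blast
        then show "2 * e < wt (enc m r - enc m' r')"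
          using R mr enc_diff by simp
      qed
    qed
    \<comment> \<open>For \<open>k' = 0\<close> the set \<open>C - U\<close> is empty and
      \<open>dX\<close> is infinite, so both sides hold for every \<open>e\<close>.\<close>
    also have "\<dots> \<longleftrightarrow> dX > enat (2 * e)"
      by (simp add: assms(6,8) dualCZ less_min_wt_iff)
    finally show ?thesis ..
  qed

  \<comment> \<open>Dual distance and zero knowledge\<close>
  moreover have "dZ > enat t \<longleftrightarrow> zero_knowledge n k' Enc t" if t: "t < n" for t
  proof
    assume "dZ > enat t"
    then have dist: "t < wt w" if "w \<in> dual_code n U" "w \<notin> dual_code n C" for w
      using that by (auto simp: assms(6,9) CZ less_min_wt_iff)
    show "zero_knowledge n k' Enc t"
      unfolding zero_knowledge_def
    proof (intro allI impI, elim conjE)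
      fix I and m m' :: "'a vec"
      assume I: "I \<subseteq> {..<n}" "card I = t" and m: "m \<in> carrier_vec k'" "m' \<in> carrier_vec k'"
      \<comment> \<open>\<open>c\<close> carries the change of message. Once it agrees on
        \<open>I\<close> with a word of \<open>U\<close>, the tail \<open>r\<^sub>0\<close> of that
        word absorbs the change as a shift of the uniform randomness.\<close>
      define c where "c = enc (m - m') (0\<^sub>v l)"
      have c: "c \<in> C" "c \<in> carrier_vec n"
        using minus_carrier_vec[OF m] zero_carrier_vec enc_carrier memC unfolding c_def by blast+
      have "\<exists>u\<in>U. \<forall>i\<in>I. c $ i = u $ i"
      \<comment> \<open>Otherwise some vector of weight at most \<open>t\<close> annihilates
        \<open>U\<close> but not \<open>C\<close>, contradicting \<open>dist\<close>.\<close>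
      proof (rule ccontr)
        assume "\<not> (\<exists>u\<in>U. \<forall>i\<in>I. c $ i = u $ i)"
        then obtain w where "w \<in> dual_code n U" "w \<bullet> c \<noteq> 0" "wt w \<le> card I"
          using dual_code_witness_on[OF linU I(1) c(2)] by blast
        moreover from this have "w \<notin> dual_code n C"
          using c by (auto simp: mem_dual_code_iff)
        ultimately show False
          using dist I by fastforce
      qed
      then obtain r\<^sub>0 where r\<^sub>0: "r\<^sub>0 \<in> carrier_vec l" "\<forall>i\<in>I. c $ i = enc (0\<^sub>v k') r\<^sub>0 $ i"
        by (auto simp: U)
      have "(\<lambda>i\<in>I. enc m r $ i) = (\<lambda>i\<in>I. enc m' (r + r\<^sub>0) $ i)" if r: "r \<in> carrier_vec l" for r
      proof (rule restrict_ext)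
        fix i assume i: "i \<in> I"
        have "m = m' + (m - m')"
          using m by auto
        then have "enc m r = enc m' r + c"
          unfolding c_def using m r by (subst enc_add) auto
        then have "enc m r $ i = enc m' r $ i + c $ i"
          using i I(1) c(2) by auto
        also have "\<dots> = (enc m' r + enc (0\<^sub>v k') r\<^sub>0) $ i"
          using i I(1) r\<^sub>0 enc_carrier[of "0\<^sub>v k'" r\<^sub>0] by auto
        also have "enc m' r + enc (0\<^sub>v k') r\<^sub>0 = enc m' (r + r\<^sub>0)"
          using m r r\<^sub>0 by (subst enc_add) auto
        finally show "enc m r $ i = enc m' (r + r\<^sub>0) $ i" .
      qed
      then show "map_pmf (\<lambda>c. \<lambda>i\<in>I. c $ i) (Enc m) = map_pmf (\<lambda>c. \<lambda>i\<in>I. c $ i) (Enc m')"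
        unfolding assms(5) by (intro map_rand_enc_cong[of r\<^sub>0]) (use r\<^sub>0 in \<open>auto simp: l_def enc_def\<close>)
    qed
  next
    assume zk: "zero_knowledge n k' Enc t"
    have "t < wt w" if w: "w \<in> dual_code n U" "w \<notin> dual_code n C" for w
    proof (rule ccontr)
      assume "\<not> t < wt w"
      have wc: "w \<in> carrier_vec n"
        using w by (simp add: mem_dual_code_iff)
      let ?S = "{i \<in> {..<n}. w $ i \<noteq> 0}"
      have "card ?S \<le> t"
        using \<open>\<not> t < wt w\<close> wc by (simp add: wt_def)
      \<comment> \<open>Zero knowledge speaks of sets of size exactly \<open>t\<close>, so the
        support of \<open>w\<close> is enlarged to one; \<open>t < n\<close> leaves room.\<close>
      then obtain I where I: "?S \<subseteq> I" "I \<subseteq> {..<n}" "card I = t"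
        using exists_subset_between[of ?S t "{..<n}"] t by auto
      obtain m r where mr: "m \<in> carrier_vec k'" "r \<in> carrier_vec l" and ne: "w \<bullet> enc m r \<noteq> 0"
        using w wc memC by (auto simp: mem_dual_code_iff)
      have "map_pmf (\<lambda>c. \<lambda>i\<in>I. c $ i) (Enc m) = map_pmf (\<lambda>c. \<lambda>i\<in>I. c $ i) (Enc (0\<^sub>v k'))"
        using zk I(2,3) mr(1) zero_carrier_vec unfolding zero_knowledge_def by blast
      \<comment> \<open>Equal distributions have equal supports, so what \<open>enc m r\<close>
        shows on \<open>I\<close> is also shown by an encoding of the zero message, a word of
        \<open>U\<close>.\<close>
      then have "(\<lambda>c. \<lambda>i\<in>I. c $ i) ` set_pmf (Enc m) = (\<lambda>c. \<lambda>i\<in>I. c $ i) ` set_pmf (Enc (0\<^sub>v k'))"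
        by (metis set_map_pmf)
      then have "(\<lambda>i\<in>I. enc m r $ i) \<in> (\<lambda>c. \<lambda>i\<in>I. c $ i) ` U"
        using mr unfolding set_Enc U by blast
      then obtain u where u: "u \<in> U" "(\<lambda>i\<in>I. enc m r $ i) = (\<lambda>i\<in>I. u $ i)"
        by auto
      have "enc m r $ i = u $ i" if "i \<in> I" for i
        using fun_cong[OF u(2), of i] that by simp
      then have "w \<bullet> enc m r = w \<bullet> u"
        using wc enc_carrier u(1) Ucar I(1) by (intro scalar_prod_cong_supp) auto
      then show False
        using ne u(1) w(1) by (simp add: mem_dual_code_iff)
    qed
    then show "dZ > enat t"
      by (auto simp: assms(6,9) CZ less_min_wt_iff)
  qed
  ultimately show ?thesis
    by blast
qed

end
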